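(* Let $\lambda>0$ and let $X_{1,1},X_{1,2},X_{2,1},X_{2,2}$ be independent random variables, each exponentially distributed with density $\lambda\exp(-\lambda x)$, $x\ge 0$. Let $\tilde X$ be the first addend of the larger of the two sums $X_{1,1}+X_{1,2}$ and $X_{2,1}+X_{2,2}$. Then $\tilde X$ has density $$f_{\tilde X}(x)=\lambda\exp(-\lambda x)\left(2-\exp(-\lambda x)\left(\lambda x+\frac32\right)\right),\qquad x\ge 0.$$
   Context: The first addend of the larger sum is $\tilde X:=X_{J,1}$, where $J\in\{1,2\}$ is the almost surely unique index maximizing $X_{j,1}+X_{j,2}$. *)

theory Defs
  imports "HOL-Probability.Probability"
begin

end

(*
  The larger sum is almost surely unique, so by exchangeability the law of the first addend of the
  larger sum is twice the law of X_{1,1} restricted to {X_{2,1} + X_{2,2} <= X_{1,1} + X_{1,2}}.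
  Given X_{1,1} = x, that event has probability E[F (x + Y)], where Y is exponential and F is the
  distribution function of the Erlang law of X_{2,1} + X_{2,2}; this expectation is
  1 - exp (-l x) (l x / 2 + 3 / 4).
*)
theory Submission
  imports Defs "HOL-Real_Asymp.Real_Asymp"
begin

text \<open>On \<open>0 \<le> y\<close> the integrand is elementary and has an explicit
  antiderivative that vanishes at infinity. Nonnegativity of \<open>x\<close> keeps
  \<open>x + y\<close> in the range where the closed form of the Erlang distribution function
  holds.\<close>

lemma nn_integral_exponential_times_erlang_CDF:
  fixes l x :: real
  assumes l: "0 < l" and x: "0 \<le> x"
  shows "(\<integral>\<^sup>+ y. ennreal (exponential_density l y) * ennreal (erlang_CDF 1 l (x + y)) \<partial>lborel)
    = ennreal (1 - exp (- l * x) * (l * x / 2 + 3 / 4))"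
proof -
  let ?f = "\<lambda>y. l * exp (- l * y) * (1 - exp (- l * (x + y)) * (1 + l * (x + y)))"
  \<comment> \<open>The second summand is an integration by parts of
    \<open>l * exp (- 2 * l * y) * (1 + l * (x + y))\<close>: the polynomial is halved by
    integrating the exponential, and its slope \<open>l\<close> contributes the extra 1/4.\<close>
  let ?F = "\<lambda>y. - exp (- l * y) + exp (- l * x) * exp (- 2 * l * y) * ((1 + l * (x + y)) / 2 + 1 / 4)"
  have CDF: "erlang_CDF 1 l t = 1 - exp (- l * t) * (1 + l * t)" if "0 \<le> t" for t
    using that by (simp add: erlang_CDF_def algebra_simps)
  have "(\<integral>\<^sup>+ y. ennreal (exponential_density l y) * ennreal (erlang_CDF 1 l (x + y)) \<partial>lborel)
    = (\<integral>\<^sup>+ y. ennreal (?f y) * indicator {0..} y \<partial>lborel)"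
    using l x
    by (intro nn_integral_cong)
       (auto simp: exponential_density_def CDF ennreal_mult'[symmetric] mult.commute simp del: One_nat_def split: split_indicator)
  also have "\<dots> = ennreal (0 - ?F 0)"
  proof (rule nn_integral_FTC_atLeast)
    show "?f \<in> borel_measurable borel" by measurable
    show "DERIV ?F y :> ?f y" if "0 \<le> y" for y
    proof -
      \<comment> \<open>With these two identities both sides of the derivative claim become
        polynomials in \<open>exp (- l * x)\<close>, \<open>exp (- l * y)\<close>, \<open>l\<close>,
        \<open>x\<close> and \<open>y\<close>, so ring normalization settles it.\<close>
      have split: "exp (- l * (x + y)) = exp (- l * x) * exp (- l * y)"
        and double: "exp (- 2 * l * y) = exp (- l * y) * exp (- l * y)"
        by (simp_all add: algebra_simps flip: exp_add)
      have "DERIV ?F y :> l * exp (- l * y)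
          + exp (- l * x) * (exp (- 2 * l * y) * (- 2 * l) * ((1 + l * (x + y)) / 2 + 1 / 4)
            + exp (- 2 * l * y) * (l / 2))"
        by (auto intro!: derivative_eq_intros simp: field_simps)
      also have "l * exp (- l * y)
          + exp (- l * x) * (exp (- 2 * l * y) * (- 2 * l) * ((1 + l * (x + y)) / 2 + 1 / 4)
            + exp (- 2 * l * y) * (l / 2)) = ?f y"
        unfolding split double by (simp add: algebra_simps)
      finally show ?thesis .
    qed
    show "0 \<le> ?f y" if "0 \<le> y" for y
      using CDF[of "x + y"] erlang_CDF_nonneg[OF l, of 1 "x + y"] that x l by simp
    show "(?F \<longlongrightarrow> 0) at_top"
      using l by real_asymp
  qed
  also have "0 - ?F 0 = 1 - exp (- l * x) * (l * x / 2 + 3 / 4)"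
    by (simp add: algebra_simps)
  finally show ?thesis .
qed

text \<open>Erlang shapes are indexed from 0: shape 0 is the exponential law, so the sum of two has
  shape 1. Composing with \<open>id\<close> replaces \<open>lborel\<close> by \<open>borel\<close>
  as the target space, as the convolution theorem for Erlang laws expects.\<close>

lemma (in prob_space) exponential_distributed_sum_two:
  fixes S T :: "'a \<Rightarrow> real"
  assumes l: "0 < l"
    and S: "distributed M lborel S (exponential_density l)"
    and T: "distributed M lborel T (exponential_density l)"
    and ind: "indep_var lborel S lborel T"
  shows "distributed M lborel (\<lambda>\<omega>. S \<omega> + T \<omega>) (erlang_density 1 l)"
proof -
  have "indep_var borel (id \<circ> S) borel (id \<circ> T)"
    using ind by (rule indep_var_compose) simp_all
  then have "indep_var borel S borel T"
    by (simp only: id_comp)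
  from sum_indep_erlang[OF this l S T] show ?thesis by simp
qed

text \<open>The two kinds of independence give the nested vector \<open>((U, V), (W, Z))\<close> a
  product density. Integrating out \<open>(W, Z)\<close> leaves the Erlang distribution function at
  \<open>U + V\<close>; integrating out \<open>V\<close> then leaves a density in the value of
  \<open>U\<close>.\<close>

lemma (in prob_space) emeasure_exponential_sum_le_exponential_sum:
  fixes U V W Z :: "'a \<Rightarrow> real" and l :: real
  assumes l: "0 < l"
    and U: "distributed M lborel U (exponential_density l)"
    and V: "distributed M lborel V (exponential_density l)"
    and W: "distributed M lborel W (exponential_density l)"
    and Z: "distributed M lborel Z (exponential_density l)"
    and indUV: "indep_var lborel U lborel V"
    and indWZ: "indep_var lborel W lborel Z"
    and ind: "indep_var (lborel \<Otimes>\<^sub>M lborel) (\<lambda>\<omega>. (U \<omega>, V \<omega>)) (lborel \<Otimes>\<^sub>M lborel) (\<lambda>\<omega>. (W \<omega>, Z \<omega>))"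
    and A: "A \<in> sets borel"
  shows "emeasure M {\<omega> \<in> space M. U \<omega> \<in> A \<and> W \<omega> + Z \<omega> \<le> U \<omega> + V \<omega>}
    = (\<integral>\<^sup>+ x. ennreal (exponential_density l x * (1 - exp (- l * x) * (l * x / 2 + 3 / 4)))
        * indicator A x \<partial>lborel)"
proof -
  note [measurable] = A
  let ?e = "\<lambda>x. ennreal (exponential_density l x)"
  let ?ee = "\<lambda>p. ?e (fst p) * ?e (snd p)"
  let ?L2 = "lborel \<Otimes>\<^sub>M lborel :: (real \<times> real) measure"
  let ?S = "{q. fst (fst q) \<in> A \<and> fst (snd q) + snd (snd q) \<le> fst (fst q) + snd (fst q)}"
  let ?T = "\<lambda>t. {p :: real \<times> real. fst p + snd p \<le> t}"
  have sigma_L2: "sigma_finite_measure ?L2"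
    by (intro sigma_finite_pair_measure sigma_finite_lborel)
  have sum: "distributed M lborel (\<lambda>\<omega>. W \<omega> + Z \<omega>) (erlang_density 1 l)"
    by (rule exponential_distributed_sum_two[OF l W Z indWZ])
  have S: "?S \<in> sets (?L2 \<Otimes>\<^sub>M ?L2)"
  proof -
    have "{q \<in> space (?L2 \<Otimes>\<^sub>M ?L2). fst (fst q) \<in> A \<and> fst (snd q) + snd (snd q) \<le> fst (fst q) + snd (fst q)}
        \<in> sets (?L2 \<Otimes>\<^sub>M ?L2)"
      by measurable
    then show ?thesis
      by (simp add: space_pair_measure)
  qed
  have T: "?T t \<in> sets ?L2" for t
  proof -
    have "{p \<in> space ?L2. fst p + snd p \<le> t} \<in> sets ?L2"
      by measurable
    then show ?thesis
      by (simp add: space_pair_measure)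
  qed
  have UV: "distributed M ?L2 (\<lambda>\<omega>. (U \<omega>, V \<omega>)) ?ee"
    using distributed_joint_indep[OF sigma_finite_lborel sigma_finite_lborel U V indUV]
    by (simp add: split_beta')
  have WZ: "distributed M ?L2 (\<lambda>\<omega>. (W \<omega>, Z \<omega>)) ?ee"
    using distributed_joint_indep[OF sigma_finite_lborel sigma_finite_lborel W Z indWZ]
    by (simp add: split_beta')
  have UVWZ: "distributed M (?L2 \<Otimes>\<^sub>M ?L2) (\<lambda>\<omega>. ((U \<omega>, V \<omega>), (W \<omega>, Z \<omega>))) (\<lambda>(p, q). ?ee p * ?ee q)"
    by (rule distributed_joint_indep[OF sigma_L2 sigma_L2 UV WZ ind])
  \<comment> \<open>The integral over the half-plane is read as a probability, first for the pair
    and then for the sum with its known Erlang law, so no convolution has to be computed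
    here.\<close>
  have sum_CDF: "(\<integral>\<^sup>+ q. ?ee q * indicator (?T t) q \<partial>?L2) = ennreal (erlang_CDF 1 l t)" for t
  proof -
    have "(\<integral>\<^sup>+ q. ?ee q * indicator (?T t) q \<partial>?L2) = emeasure M ((\<lambda>\<omega>. (W \<omega>, Z \<omega>)) -` ?T t \<inter> space M)"
      by (rule distributed_emeasure[OF WZ T, symmetric])
    also have "\<dots> = emeasure M ((\<lambda>\<omega>. W \<omega> + Z \<omega>) -` {..t} \<inter> space M)"
      by (intro arg_cong2[where f = emeasure]) auto
    also have "\<dots> = ennreal (erlang_CDF 1 l t)"
      by (subst distributed_emeasure[OF sum]) (simp_all add: nn_integral_erlang_density[OF l])
    finally show ?thesis .
  qed
  have "emeasure M {\<omega> \<in> space M. U \<omega> \<in> A \<and> W \<omega> + Z \<omega> \<le> U \<omega> + V \<omega>}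
      = emeasure M ((\<lambda>\<omega>. ((U \<omega>, V \<omega>), (W \<omega>, Z \<omega>))) -` ?S \<inter> space M)"
    by (intro arg_cong2[where f = emeasure]) auto
  also have "\<dots> = (\<integral>\<^sup>+ r. (case r of (p, q) \<Rightarrow> ?ee p * ?ee q) * indicator ?S r \<partial>(?L2 \<Otimes>\<^sub>M ?L2))"
    by (rule distributed_emeasure[OF UVWZ S])
  \<comment> \<open>Tonelli with \<open>(W, Z)\<close> as inner variable: for fixed \<open>p\<close>
    the section of \<open>?S\<close> is the half-plane \<open>?T (fst p + snd p)\<close> when
    \<open>fst p\<close> lies in \<open>A\<close>, and empty otherwise.\<close>
  also have "\<dots> = (\<integral>\<^sup>+ p. \<integral>\<^sup>+ q. ?ee p * ?ee q * indicator ?S (p, q) \<partial>?L2 \<partial>?L2)"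
    using S by (subst sigma_finite_measure.nn_integral_fst[OF sigma_L2, symmetric]) (auto simp: split_beta')
  also have "\<dots> = (\<integral>\<^sup>+ p. ?e (fst p) * indicator A (fst p) * (?e (snd p) * ennreal (erlang_CDF 1 l (fst p + snd p))) \<partial>?L2)"
  proof (rule nn_integral_cong)
    fix p :: "real \<times> real"
    have "(\<integral>\<^sup>+ q. ?ee p * ?ee q * indicator ?S (p, q) \<partial>?L2)
      = (\<integral>\<^sup>+ q. (?ee p * indicator A (fst p)) * (?ee q * indicator (?T (fst p + snd p)) q) \<partial>?L2)"
      by (intro nn_integral_cong) (auto split: split_indicator)
    also have "\<dots> = (?ee p * indicator A (fst p)) * ennreal (erlang_CDF 1 l (fst p + snd p))"
      using T by (subst nn_integral_cmult) (auto simp: sum_CDF)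
    finally show "(\<integral>\<^sup>+ q. ?ee p * ?ee q * indicator ?S (p, q) \<partial>?L2)
      = ?e (fst p) * indicator A (fst p) * (?e (snd p) * ennreal (erlang_CDF 1 l (fst p + snd p)))"
      by (simp add: mult_ac)
  qed
  also have "\<dots> = (\<integral>\<^sup>+ u. \<integral>\<^sup>+ v. ?e u * indicator A u * (?e v * ennreal (erlang_CDF 1 l (u + v))) \<partial>lborel \<partial>lborel)"
    by (subst lborel.nn_integral_fst[symmetric]) (auto simp: erlang_CDF_def[abs_def])
  also have "\<dots> = (\<integral>\<^sup>+ u. ennreal (exponential_density l u * (1 - exp (- l * u) * (l * u / 2 + 3 / 4)))
        * indicator A u \<partial>lborel)"
  proof (rule nn_integral_cong)
    fix u :: real
    have "(\<integral>\<^sup>+ v. ?e u * indicator A u * (?e v * ennreal (erlang_CDF 1 l (u + v))) \<partial>lborel)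
      = ?e u * indicator A u * (\<integral>\<^sup>+ v. ?e v * ennreal (erlang_CDF 1 l (u + v)) \<partial>lborel)"
      by (subst nn_integral_cmult) (auto simp: erlang_CDF_def[abs_def])
    also have "\<dots> = ennreal (exponential_density l u * (1 - exp (- l * u) * (l * u / 2 + 3 / 4))) * indicator A u"
    \<comment> \<open>For negative \<open>u\<close> the exponential density makes both sides zero;
      the closed form of the integral is available for the remaining \<open>u\<close>.\<close>
    proof (cases "u < 0")
      case True
      then show ?thesis by (simp add: exponential_density_def)
    next
      case False
      then show ?thesis
        using l by (simp add: nn_integral_exponential_times_erlang_CDF ennreal_mult' mult_ac del: One_nat_def)
    qed
    finally show "(\<integral>\<^sup>+ v. ?e u * indicator A u * (?e v * ennreal (erlang_CDF 1 l (u + v))) \<partial>lborel)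
      = ennreal (exponential_density l u * (1 - exp (- l * u) * (l * u / 2 + 3 / 4))) * indicator A u" .
  qed
  finally show ?thesis .
qed

text \<open>The joint law has a density with respect to Lebesgue measure on the plane, and the
  diagonal is a null set there because each of its sections is a single point.\<close>

lemma (in prob_space) indep_distributed_AE_neq:
  fixes S T :: "'a \<Rightarrow> real"
  assumes S: "distributed M lborel S f" and T: "distributed M lborel T g"
    and ind: "indep_var lborel S lborel T"
  shows "AE \<omega> in M. S \<omega> \<noteq> T \<omega>"
proof -
  have ST: "distributed M (lborel \<Otimes>\<^sub>M lborel) (\<lambda>\<omega>. (S \<omega>, T \<omega>)) (\<lambda>(s, t). f s * g t)"
    using sigma_finite_lborel S T ind by (intro distributed_joint_indep) auto
  have "AE p in lborel \<Otimes>\<^sub>M lborel. fst p \<noteq> (snd p :: real)"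
  proof (rule lborel_pair.AE_pair_measure)
    show "{p \<in> space (lborel \<Otimes>\<^sub>M lborel). fst p \<noteq> (snd p :: real)} \<in> sets (lborel \<Otimes>\<^sub>M lborel)"
      by measurable
    show "AE s in lborel. AE t in lborel. fst (s, t) \<noteq> (snd (s, t) :: real)"
      proof (rule AE_I2)
      fix s :: real
      show "AE t in lborel. fst (s, t) \<noteq> snd (s, t)"
        using AE_lborel_singleton[of s] by (auto elim: eventually_mono)
    qed
  qed
  then have "AE p in density (lborel \<Otimes>\<^sub>M lborel) (\<lambda>(s, t). f s * g t). fst p \<noteq> snd p"
    using distributed_borel_measurable[OF ST] by (subst AE_density) auto
  then have "AE p in distr M (lborel \<Otimes>\<^sub>M lborel) (\<lambda>\<omega>. (S \<omega>, T \<omega>)). fst p \<noteq> snd p"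
    unfolding distributed_distr_eq_density[OF ST] .
  then have "AE \<omega> in M. fst (S \<omega>, T \<omega>) \<noteq> snd (S \<omega>, T \<omega>)"
    by (rule AE_distrD[OF distributed_measurable[OF ST]])
  then show ?thesis by simp
qed

theorem mainTheorem7:
  fixes M :: "'a measure" and X :: "nat \<Rightarrow> nat \<Rightarrow> 'a \<Rightarrow> real"
    and J :: "'a \<Rightarrow> nat" and l :: real
  assumes "prob_space M"
    and "l > 0"
    and "prob_space.indep_vars M (\<lambda>_. borel) (\<lambda>(j, i). X j i) ({1, 2} \<times> {1, 2})"
    and "\<And>j i. j \<in> {1, 2} \<Longrightarrow> i \<in> {1, 2} \<Longrightarrow>
           distributed M lborel (X j i) (\<lambda>x. ennreal (exponential_density l x))"
    and "J \<in> measurable M (count_space {1, 2})"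
    and "AE \<omega> in M. is_arg_max (\<lambda>j. X j 1 \<omega> + X j 2 \<omega>) (\<lambda>j. j \<in> {1, 2}) (J \<omega>)"
  shows "distributed M lborel (\<lambda>\<omega>. X (J \<omega>) 1 \<omega>)
           (\<lambda>x. ennreal (if x < 0 then 0
              else l * exp (- l * x) * (2 - exp (- l * x) * (l * x + 3 / 2))))"
proof -
  interpret prob_space M by fact
  note l = assms(2) and dist = assms(4) and J[measurable] = assms(5) and max = assms(6)
  define I :: "(nat \<times> nat) set" where "I = {1, 2} \<times> {1, 2}"
  define f where "f x = (if x < 0 then 0
              else l * exp (- l * x) * (2 - exp (- l * x) * (l * x + 3 / 2)))" for x
  \<comment> \<open>This is the density of the first addend of one fixed pair, restricted to the
    event that this pair has the larger sum; its total mass is therefore not 1, and it is half of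
    \<open>f\<close>.\<close>
  define h where "h x = exponential_density l x * (1 - exp (- l * x) * (l * x / 2 + 3 / 4))" for x
  have X_meas: "X j i \<in> borel_measurable M" if "j \<in> {1, 2}" "i \<in> {1, 2}" for j i
    using distributed_measurable[OF dist[OF that]] by simp
  have [measurable]: "X 1 1 \<in> borel_measurable M" "X 1 2 \<in> borel_measurable M"
      "X 2 1 \<in> borel_measurable M" "X 2 2 \<in> borel_measurable M"
    by (simp_all add: X_meas del: One_nat_def)
  have indep: "indep_vars (\<lambda>_. borel) (\<lambda>(j, i). X j i) I"
    unfolding I_def by fact
  \<comment> \<open>Disjoint index sets give independent subfamilies; evaluating the restricted
    families at their single indices recovers the two variables.\<close>
  have within: "indep_var lborel (X j 1) lborel (X j 2)" if "j \<in> {1, 2}" for j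
  proof -
    have "indep_var (PiM {(j, 1)} (\<lambda>_. borel)) (\<lambda>\<omega>. restrict (\<lambda>q. (case q of (j, i) \<Rightarrow> X j i) \<omega>) {(j, 1)})
        (PiM {(j, 2)} (\<lambda>_. borel)) (\<lambda>\<omega>. restrict (\<lambda>q. (case q of (j, i) \<Rightarrow> X j i) \<omega>) {(j, 2)})"
      using that by (intro indep_var_restrict[OF indep]) (auto simp: I_def)
    from indep_var_compose[OF this, of "\<lambda>r. r (j, 1)" lborel "\<lambda>r. r (j, 2)" lborel]
    show ?thesis by (simp add: comp_def)
  qed
  have across: "indep_var (lborel \<Otimes>\<^sub>M lborel) (\<lambda>\<omega>. (X j 1 \<omega>, X j 2 \<omega>))
      (lborel \<Otimes>\<^sub>M lborel) (\<lambda>\<omega>. (X k 1 \<omega>, X k 2 \<omega>))"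
    if "j \<in> {1, 2}" "k \<in> {1, 2}" "j \<noteq> k" for j k
  proof -
    have "indep_var (PiM ({j} \<times> {1, 2}) (\<lambda>_. borel)) (\<lambda>\<omega>. restrict (\<lambda>q. (case q of (j, i) \<Rightarrow> X j i) \<omega>) ({j} \<times> {1, 2}))
        (PiM ({k} \<times> {1, 2}) (\<lambda>_. borel)) (\<lambda>\<omega>. restrict (\<lambda>q. (case q of (j, i) \<Rightarrow> X j i) \<omega>) ({k} \<times> {1, 2}))"
      using that by (intro indep_var_restrict[OF indep]) (auto simp: I_def)
    moreover have pair: "(\<lambda>r. (r (m, 1), r (m, 2)))
        \<in> measurable (PiM ({m} \<times> {1, 2 :: nat}) (\<lambda>_. borel)) (lborel \<Otimes>\<^sub>M lborel :: (real \<times> real) measure)" for m :: nat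
    proof -
      have component: "(\<lambda>r. r (m, i)) \<in> measurable (PiM ({m} \<times> {1, 2 :: nat}) (\<lambda>_. borel)) (lborel :: real measure)"
        if "i \<in> {1, 2}" for i :: nat
        using measurable_component_singleton[of "(m, i)" "{m} \<times> {1, 2}" "\<lambda>_. borel :: real measure"] that
        unfolding measurable_lborel1 by blast
      show ?thesis
        by (rule measurable_Pair; rule component; simp)
    qed
    ultimately have "indep_var (lborel \<Otimes>\<^sub>M lborel)
        ((\<lambda>r. (r (j, 1), r (j, 2))) \<circ> (\<lambda>\<omega>. restrict (\<lambda>q. (case q of (j, i) \<Rightarrow> X j i) \<omega>) ({j} \<times> {1, 2})))
        (lborel \<Otimes>\<^sub>M lborel)
        ((\<lambda>r. (r (k, 1), r (k, 2))) \<circ> (\<lambda>\<omega>. restrict (\<lambda>q. (case q of (j, i) \<Rightarrow> X j i) \<omega>) ({k} \<times> {1, 2})))"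
      using pair by (rule indep_var_compose)
    moreover have "(\<lambda>r. (r (m, 1), r (m, 2))) \<circ> (\<lambda>\<omega>. restrict (\<lambda>q. (case q of (j, i) \<Rightarrow> X j i) \<omega>) ({m} \<times> {1, 2}))
        = (\<lambda>\<omega>. (X m 1 \<omega>, X m 2 \<omega>))" for m
      by (simp add: fun_eq_iff)
    ultimately show ?thesis by (simp only:)
  qed
  \<comment> \<open>Exchangeability enters here: the right-hand side does not depend on the ordered
    pair \<open>(j, k)\<close>, so both choices of the winning pair contribute equally.\<close>
  have half: "emeasure M {\<omega> \<in> space M. X j 1 \<omega> \<in> A \<and> X k 1 \<omega> + X k 2 \<omega> \<le> X j 1 \<omega> + X j 2 \<omega>}
      = (\<integral>\<^sup>+ x. ennreal (h x) * indicator A x \<partial>lborel)"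
    if "j \<in> {1, 2}" "k \<in> {1, 2}" "j \<noteq> k" "A \<in> sets borel" for j k A
    unfolding h_def
    by (rule emeasure_exponential_sum_le_exponential_sum[OF l dist dist dist dist within within
          across]) (use that in simp_all)
  have no_tie: "AE \<omega> in M. X 1 1 \<omega> + X 1 2 \<omega> \<noteq> X 2 1 \<omega> + X 2 2 \<omega>"
  proof (rule indep_distributed_AE_neq)
    show "indep_var lborel (\<lambda>\<omega>. X 1 1 \<omega> + X 1 2 \<omega>) lborel (\<lambda>\<omega>. X 2 1 \<omega> + X 2 2 \<omega>)"
      using indep_var_compose[OF across[of 1 2], of "\<lambda>p. fst p + snd p" lborel "\<lambda>p. fst p + snd p" lborel]
      by (simp add: comp_def)
  qed (rule exponential_distributed_sum_two[OF l dist dist within]; simp)+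
  have J_cases: "J \<omega> = 1 \<or> J \<omega> = 2" if "\<omega> \<in> space M" for \<omega>
    using measurable_space[OF J that] by simp
  \<comment> \<open>Writing the randomly indexed variable as a choice between two fixed ones reduces
    its measurability to theirs and that of \<open>J\<close>.\<close>
  have XJ_eq: "X (J \<omega>) 1 \<omega> = (if J \<omega> = 1 then X 1 1 \<omega> else X 2 1 \<omega>)" if "\<omega> \<in> space M" for \<omega>
    using J_cases[OF that] by auto
  have XJ[measurable]: "(\<lambda>\<omega>. X (J \<omega>) 1 \<omega>) \<in> borel_measurable M"
    by (subst measurable_cong[OF XJ_eq]) (auto intro!: measurable_If)
  have f_eq: "f x = 2 * h x" for x
    by (simp add: f_def h_def exponential_density_def algebra_simps)
  have f_meas[measurable]: "f \<in> borel_measurable borel" unfolding f_def by measurable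
  have h_meas[measurable]: "h \<in> borel_measurable borel" unfolding h_def by measurable
  have "distributed M lborel (\<lambda>\<omega>. X (J \<omega>) 1 \<omega>) (\<lambda>x. ennreal (f x))"
    unfolding distributed_def
  proof (intro conjI measure_eqI)
    fix A :: "real set" assume "A \<in> sets (distr M lborel (\<lambda>\<omega>. X (J \<omega>) 1 \<omega>))"
    then have A[measurable]: "A \<in> sets borel" by simp
    let ?E = "\<lambda>j k. {\<omega> \<in> space M. X j 1 \<omega> \<in> A \<and> X k 1 \<omega> + X k 2 \<omega> \<le> X j 1 \<omega> + X j 2 \<omega>}"
    have E_meas: "?E 1 2 \<in> sets M" "?E 2 1 \<in> sets M" by measurable
    have "emeasure (distr M lborel (\<lambda>\<omega>. X (J \<omega>) 1 \<omega>)) A = emeasure M {\<omega> \<in> space M. X (J \<omega>) 1 \<omega> \<in> A}"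
      using XJ by (subst emeasure_distr) (auto intro!: arg_cong2[where f = emeasure])
    also have "\<dots> = emeasure M (?E 1 2) + emeasure M (?E 2 1)"
    \<comment> \<open>The events \<open>?E 1 2\<close> and \<open>?E 2 1\<close> can overlap only at
      ties, a null set. Away from ties, \<open>J\<close> is the index of the strictly larger sum, so
      exactly one of the two comparisons holds and it selects
      \<open>X (J \<omega>) 1 \<omega>\<close>.\<close>
    proof (rule emeasure_add_AE)
      show "{\<omega> \<in> space M. X (J \<omega>) 1 \<omega> \<in> A} \<in> sets M" by measurable
      show "AE \<omega> in M. \<omega> \<in> {\<omega> \<in> space M. X (J \<omega>) 1 \<omega> \<in> A} \<longleftrightarrow> \<omega> \<in> ?E 1 2 \<or> \<omega> \<in> ?E 2 1"
        using max no_tie AE_space by eventually_elim (auto simp: is_arg_max_def)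
      show "AE \<omega> in M. \<not> (\<omega> \<in> ?E 1 2 \<and> \<omega> \<in> ?E 2 1)"
        using no_tie by eventually_elim auto
    qed (rule E_meas)+
    also have "\<dots> = 2 * (\<integral>\<^sup>+ x. ennreal (h x) * indicator A x \<partial>lborel)"
      by (simp add: half mult_2 del: One_nat_def)
    also have "\<dots> = (\<integral>\<^sup>+ x. 2 * (ennreal (h x) * indicator A x) \<partial>lborel)"
      by (subst nn_integral_cmult) auto
    also have "\<dots> = emeasure (density lborel (\<lambda>x. ennreal (f x))) A"
      by (subst emeasure_density) (auto intro!: nn_integral_cong simp: f_eq ennreal_mult' mult.assoc)
    finally show "emeasure (distr M lborel (\<lambda>\<omega>. X (J \<omega>) 1 \<omega>)) A
        = emeasure (density lborel (\<lambda>x. ennreal (f x))) A" .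
  qed (use XJ in auto)
  then show ?thesis by (simp add: f_def)
qed

end
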